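(* Let $(S,+)$ be a commutative cancellative semigroup and let $S-S$ denote its difference group. If $A\subseteq S$ is quasi-central in $S$, then $A$ is quasi-central in $S-S$.
   Context: For a commutative cancellative semigroup $(S,+)$, the difference group $(S-S,+)$ consists of all $a-b$ with $a,b\in S$, where $a-b$ is the element with $b+(a-b)=a$; it is a commutative group and $S\subseteq S-S$. For a commutative semigroup $(X,+)$, $B\subseteq X$ and $t\in X$, write $-t+B=\{y\in X:t+y\in B\}$. $B$ is thick in $X$ if for every finite nonempty $F\subseteq X$ there is $x\in X$ with $F+x\subseteq B$; $B$ is piecewise syndetic in $X$ if there is a finite nonempty $G\subseteq X$ with $\bigcup_{t\in G}(-t+B)$ thick in $X$. A family $\langle C_F\rangle_{F\in\mathcal I}$ is downward directed if $(\mathcal I,\geq)$ is a directed set and $F\geq G$ implies $C_F\subseteq C_G$. A set $A\subseteq X$ is quasi-central in $X$ if there is a downward directed family $\langle C_F\rangle_{F\in\mathcal I}$ of subsets of $A$ such that (1) for each $F\in\mathcal I$ and each $x\in C_F$ there is $G\in\mathcal I$ with $C_G\subseteq -x+C_F$, and (2) each $C_F$ is piecewise syndetic in $X$. *)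

theory Defs
  imports Main
begin

section \<open>Notions of size in a commutative semigroup\<close>

definition shift_vimage :: "'a::ab_semigroup_add \<Rightarrow> 'a set \<Rightarrow> 'a set" where
  "shift_vimage t B = {y. t + y \<in> B}"

definition thick :: "'a::ab_semigroup_add set \<Rightarrow> bool" where
  "thick B \<longleftrightarrow> (\<forall>F. finite F \<and> F \<noteq> {} \<longrightarrow> (\<exists>x. (\<lambda>f. f + x) ` F \<subseteq> B))"

definition piecewise_syndetic :: "'a::ab_semigroup_add set \<Rightarrow> bool" where
  "piecewise_syndetic B \<longleftrightarrow>
     (\<exists>G. finite G \<and> G \<noteq> {} \<and> thick (\<Union>t\<in>G. shift_vimage t B))"

definition directed_set :: "'i set \<Rightarrow> ('i \<Rightarrow> 'i \<Rightarrow> bool) \<Rightarrow> bool" where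
  "directed_set I ge \<longleftrightarrow>
     I \<noteq> {} \<and> reflp_on I ge \<and> transp_on I ge \<and>
     (\<forall>F\<in>I. \<forall>G\<in>I. \<exists>H\<in>I. ge H F \<and> ge H G)"

definition downward_directed ::
    "'i set \<Rightarrow> ('i \<Rightarrow> 'i \<Rightarrow> bool) \<Rightarrow> ('i \<Rightarrow> 'a set) \<Rightarrow> bool" where
  "downward_directed I ge C \<longleftrightarrow>
     directed_set I ge \<and> (\<forall>F\<in>I. \<forall>G\<in>I. ge F G \<longrightarrow> C F \<subseteq> C G)"

definition quasi_central_witness ::
    "'a::ab_semigroup_add set \<Rightarrow> 'i set \<Rightarrow> ('i \<Rightarrow> 'i \<Rightarrow> bool) \<Rightarrow> ('i \<Rightarrow> 'a set) \<Rightarrow> bool" where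
  "quasi_central_witness A I ge C \<longleftrightarrow>
     downward_directed I ge C \<and> (\<forall>F\<in>I. C F \<subseteq> A) \<and>
     (\<forall>F\<in>I. \<forall>x\<in>C F. \<exists>G\<in>I. C G \<subseteq> shift_vimage x (C F)) \<and>
     (\<forall>F\<in>I. piecewise_syndetic (C F))"

text \<open>
  HOL cannot quantify over the type of indices inside a formula, so the index set is drawn from
  the type \<open>'a set\<close>. This loses no generality: by \<open>quasi_centralI\<close> below, a
  witnessing family over any index type whatsoever suffices.
\<close>

definition quasi_central :: "'a::ab_semigroup_add set \<Rightarrow> bool" where
  "quasi_central A \<longleftrightarrow>
     (\<exists>(I :: 'a set set) ge (C :: 'a set \<Rightarrow> 'a set). quasi_central_witness A I ge C)"

lemma quasi_centralI:
  fixes I :: "'i set"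
  assumes "quasi_central_witness A I ge C"
  shows "quasi_central A"
proof -
  have dir: "I \<noteq> {}" "\<forall>F\<in>I. \<forall>G\<in>I. \<exists>H\<in>I. ge H F \<and> ge H G"
    and mono: "\<forall>F\<in>I. \<forall>G\<in>I. ge F G \<longrightarrow> C F \<subseteq> C G"
    using assms
    unfolding quasi_central_witness_def downward_directed_def directed_set_def by simp_all
  have sub: "\<forall>F\<in>I. \<forall>G\<in>I. \<exists>H\<in>I. C H \<subseteq> C F \<and> C H \<subseteq> C G"
    using dir(2) mono by meson
  have "downward_directed (C ` I) (\<subseteq>) (\<lambda>X. X)"
    unfolding downward_directed_def directed_set_def
    using \<open>I \<noteq> {}\<close> sub by (auto intro!: reflp_onI transp_onI)
  then have "quasi_central_witness A (C ` I) (\<subseteq>) (\<lambda>X. X)"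
    using assms unfolding quasi_central_witness_def by auto
  then show ?thesis
    unfolding quasi_central_def by blast
qed


section \<open>The difference group of a commutative cancellative semigroup\<close>

text \<open>
  The class \<open>cancel_ab_semigroup_add\<close> is avoided: it presupposes a truncating
  subtraction operation, which is not part of the structure of a commutative cancellative
  semigroup. A pair \<open>(a, b)\<close> represents the formal difference of \<open>a\<close> and \<open>b\<close>.
\<close>

definition diff_rel ::
    "'a::{ab_semigroup_add,cancel_semigroup_add} \<times> 'a \<Rightarrow> 'a \<times> 'a \<Rightarrow> bool" where
  "diff_rel p q \<longleftrightarrow> fst p + snd q = fst q + snd p"

lemma equivp_diff_rel:
  "equivp (diff_rel :: 'a::{ab_semigroup_add,cancel_semigroup_add} \<times> 'a \<Rightarrow> _)"
proof (rule equivpI)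
  show "reflp (diff_rel :: 'a \<times> 'a \<Rightarrow> _)" by (simp add: reflp_def diff_rel_def)
  show "symp (diff_rel :: 'a \<times> 'a \<Rightarrow> _)" by (simp add: symp_def diff_rel_def)
  show "transp (diff_rel :: 'a \<times> 'a \<Rightarrow> _)"
  proof (rule transpI)
    fix p q r :: "'a \<times> 'a"
    assume "diff_rel p q" "diff_rel q r"
    then have 1: "fst p + snd q = fst q + snd p" and 2: "fst q + snd r = fst r + snd q"
      by (simp_all add: diff_rel_def)
    have "snd q + (fst p + snd r) = (fst p + snd q) + snd r" by (simp add: ac_simps)
    also have "\<dots> = (fst q + snd r) + snd p" by (simp add: 1 ac_simps)
    also have "\<dots> = snd q + (fst r + snd p)" by (simp add: 2 ac_simps)
    finally show "diff_rel p r" by (simp add: diff_rel_def)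
  qed
qed

quotient_type (overloaded) 'a diff_group =
  "'a::{ab_semigroup_add,cancel_semigroup_add} \<times> 'a" / diff_rel
  by (rule equivp_diff_rel)

instantiation diff_group :: ("{ab_semigroup_add,cancel_semigroup_add}") ab_group_add
begin

lift_definition zero_diff_group :: "'a diff_group" is "(undefined, undefined)" .

lift_definition plus_diff_group :: "'a diff_group \<Rightarrow> 'a diff_group \<Rightarrow> 'a diff_group"
  is "\<lambda>p q. (fst p + fst q, snd p + snd q)"
proof -
  fix p p' q q' :: "'a \<times> 'a"
  assume "diff_rel p p'" "diff_rel q q'"
  then have 1: "fst p + snd p' = fst p' + snd p" and 2: "fst q + snd q' = fst q' + snd q"
    by (simp_all add: diff_rel_def)
  have "(fst p + fst q) + (snd p' + snd q') = (fst p + snd p') + (fst q + snd q')"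
    by (simp add: ac_simps)
  also have "\<dots> = (fst p' + fst q') + (snd p + snd q)"
    unfolding 1 2 by (simp add: ac_simps)
  finally show "diff_rel (fst p + fst q, snd p + snd q) (fst p' + fst q', snd p' + snd q')"
    by (simp add: diff_rel_def)
qed

lift_definition uminus_diff_group :: "'a diff_group \<Rightarrow> 'a diff_group"
  is "\<lambda>p. (snd p, fst p)"
  by (simp add: diff_rel_def add.commute)

definition minus_diff_group :: "'a diff_group \<Rightarrow> 'a diff_group \<Rightarrow> 'a diff_group" where
  "minus_diff_group x y = x + - y"

instance
  by standard
    (simp add: minus_diff_group_def | (transfer, simp add: diff_rel_def ac_simps))+

end

text \<open>
  The inclusion of the semigroup in its difference group, \<open>s = (s + s) - s\<close>; the lemmas below
  are the properties that determine the difference group together with this inclusion.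
\<close>

lift_definition to_diff_group ::
    "'a::{ab_semigroup_add,cancel_semigroup_add} \<Rightarrow> 'a diff_group"
  is "\<lambda>s. (s + s, s)" .

lemma to_diff_group_add: "to_diff_group (a + b) = to_diff_group a + to_diff_group b"
  by transfer (simp add: diff_rel_def ac_simps)

lemma inj_to_diff_group: "inj to_diff_group"
proof (rule injI)
  fix a b :: 'a
  assume "to_diff_group a = to_diff_group b"
  then have "a + a + b = b + b + a"
    by transfer (simp add: diff_rel_def)
  then have "(a + b) + a = (a + b) + b" by (simp add: ac_simps)
  then show "a = b" by simp
qed

lemma diff_group_eq_diff: "\<exists>a b. x = to_diff_group a - to_diff_group b"
proof -
  have "\<exists>a b. x = to_diff_group a + - to_diff_group b"
    by transfer (auto simp: diff_rel_def ac_simps)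
  then show ?thesis by simp
qed

end

theory Submission
  imports Defs
begin

text \<open>
  A finite subset of the difference group is translated into the semigroup by a common denominator.
  Hence thickness, and with it piecewise syndeticity, passes to the image in the difference group,
  and the image of a witnessing family is again a witnessing family.
\<close>

text \<open>Induction on \<open>F\<close>: if \<open>c\<close> clears the denominators of
  \<open>F\<close> and \<open>f = a - b\<close>, then \<open>c + b\<close> clears those of
  \<open>insert f F\<close>. The old elements stay in the semigroup because it is closed under
  adding \<open>b\<close>.\<close>

lemma common_denominator:
  fixes F :: "'a::{ab_semigroup_add,cancel_semigroup_add} diff_group set"
  assumes "finite F"
  shows "\<exists>c. \<forall>f\<in>F. f + to_diff_group c \<in> range to_diff_group"
  using assms
proof induction
  case empty
  show ?case by simp
next
  case (insert f F)
  then obtain c where c: "\<forall>g\<in>F. g + to_diff_group c \<in> range to_diff_group"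
    by blast
  obtain a b where f: "f = to_diff_group a - to_diff_group b"
    using diff_group_eq_diff by blast
  have "f + to_diff_group (c + b) = to_diff_group (a + c)"
    by (simp add: f to_diff_group_add)
  moreover have "g + to_diff_group (c + b) \<in> range to_diff_group" if "g \<in> F" for g
  proof -
    obtain d where "g + to_diff_group c = to_diff_group d"
      using c \<open>g \<in> F\<close> by blast
    then have "g + to_diff_group (c + b) = to_diff_group (d + b)"
      by (simp add: to_diff_group_add add.assoc [symmetric])
    then show ?thesis by simp
  qed
  ultimately show ?case by (metis insert_iff rangeI)
qed

lemma thick_mono: "thick B \<Longrightarrow> B \<subseteq> C \<Longrightarrow> thick C"
  unfolding thick_def by (meson order_trans)

lemma thick_to_diff_group:
  assumes "thick B"
  shows "thick (to_diff_group ` B)"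
  unfolding thick_def
proof (intro allI impI)
  fix F :: "'a diff_group set"
  assume F: "finite F \<and> F \<noteq> {}"
  then obtain c where "\<forall>f\<in>F. f + to_diff_group c \<in> range to_diff_group"
    using common_denominator by blast
  then have "\<forall>f\<in>F. \<exists>s. f + to_diff_group c = to_diff_group s"
    by blast
  then obtain h where h: "\<And>f. f \<in> F \<Longrightarrow> f + to_diff_group c = to_diff_group (h f)"
    by (auto dest: bchoice)
  obtain x where x: "(\<lambda>s. s + x) ` h ` F \<subseteq> B"
    using assms [unfolded thick_def, rule_format, of "h ` F"] F by auto
  have "f + to_diff_group (c + x) \<in> to_diff_group ` B" if "f \<in> F" for f
  proof -
    have "f + to_diff_group (c + x) = to_diff_group (h f + x)"
      using h [OF that] by (simp add: to_diff_group_add add.assoc [symmetric])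
    then show ?thesis using x that by auto
  qed
  then show "\<exists>y. (\<lambda>f. f + y) ` F \<subseteq> to_diff_group ` B" by blast
qed

text \<open>Equality can fail, since the shift in the group may contain differences outside the
  semigroup. The inclusion points the right way: thickness passes to supersets, and condition (1)
  only asks for a containing shift.\<close>

lemma to_diff_group_shift_vimage_subset:
  "to_diff_group ` shift_vimage t B \<subseteq> shift_vimage (to_diff_group t) (to_diff_group ` B)"
  by (auto simp: shift_vimage_def simp flip: to_diff_group_add)

lemma piecewise_syndetic_to_diff_group:
  assumes "piecewise_syndetic B"
  shows "piecewise_syndetic (to_diff_group ` B)"
proof -
  obtain G where G: "finite G" "G \<noteq> {}" "thick (\<Union>t\<in>G. shift_vimage t B)"
    using assms unfolding piecewise_syndetic_def by blast
  \<comment> \<open>The finite set of shifts for the image of \<open>B\<close> is the image of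
    \<open>G\<close>.\<close>
  have "to_diff_group ` (\<Union>t\<in>G. shift_vimage t B)
      \<subseteq> (\<Union>t\<in>to_diff_group ` G. shift_vimage t (to_diff_group ` B))"
    using to_diff_group_shift_vimage_subset by blast
  then have "thick (\<Union>t\<in>to_diff_group ` G. shift_vimage t (to_diff_group ` B))"
    using thick_to_diff_group [OF G(3)] thick_mono by blast
  then show ?thesis
    unfolding piecewise_syndetic_def using G(1,2) by (meson finite_imageI image_is_empty)
qed

lemma quasi_central_witness_to_diff_group:
  assumes "quasi_central_witness A I ge C"
  shows "quasi_central_witness (to_diff_group ` A) I ge (\<lambda>F. to_diff_group ` C F)"
proof -
  have "\<exists>G\<in>I. to_diff_group ` C G \<subseteq> shift_vimage y (to_diff_group ` C F)"
    if F: "F \<in> I" and y: "y \<in> to_diff_group ` C F" for F y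
  proof -
    obtain x where x: "x \<in> C F" "y = to_diff_group x"
      using y by blast
    \<comment> \<open>Every point of the image of \<open>C F\<close> comes from some
      \<open>x\<close> in \<open>C F\<close>, so the index chosen for \<open>x\<close> in the
      semigroup serves again.\<close>
    then obtain G where "G \<in> I" "C G \<subseteq> shift_vimage x (C F)"
      using assms F unfolding quasi_central_witness_def by blast
    then show ?thesis
      using to_diff_group_shift_vimage_subset x(2) by blast
  qed
  then show ?thesis
    using assms
    by (simp add: quasi_central_witness_def downward_directed_def image_mono
        piecewise_syndetic_to_diff_group)
qed

theorem theorem2p3:
  fixes A :: "'a::{ab_semigroup_add,cancel_semigroup_add} set"
  assumes "quasi_central A"
  shows "quasi_central (to_diff_group ` A)"
proof -
  obtain I ge and C :: "'a set \<Rightarrow> 'a set" where "quasi_central_witness A I ge C"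
    using assms unfolding quasi_central_def by blast
  \<comment> \<open>The transported family is still indexed by sets of type \<open>'a set\<close>,
    whereas \<open>quasi_central\<close> in the group expects indices of type
    \<open>'a diff_group set\<close>; \<open>quasi_centralI\<close> reindexes the family by its own
    members.\<close>
  then show ?thesis
    by (rule quasi_centralI [OF quasi_central_witness_to_diff_group])
qed

end
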